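(* Let $X$ and $Y$ be real linear spaces. Let $A:X\to Y$ be a linear operator, $B:X\to\mathbb{R}$ a linear function, $a\in Y$ a vector, and $b\in\mathbb{R}$ a scalar. Let $D=\{x\in X\mid B(x)+b>0\}$ and let $f:D\to Y$ be given by $$f(x)=\frac{A(x)+a}{B(x)+b}\qquad (x\in D).$$ Then $f$ is a strict segment preserving function, i.e., $f(]x,y[)=\,]f(x),f(y)[$ for all $x,y\in D$.
   Context: For points $u,v$ of a real linear space, the open segment is $]u,v[\,:=\{tu+(1-t)v\mid 0<t<1\}$; in particular $]u,u[\,=\{u\}$. A map $f:D\to Y$ on a convex set $D\subseteq X$ is called strict segment preserving if $f(]x,y[)=\,]f(x),f(y)[$ for all $x,y\in D$. *)

theory Defs
  imports "HOL-Analysis.Convex"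
begin

(* Unlike the library's open_segment, this is the singleton {u} (not empty) when u = v. *)
definition oseg :: "'a::real_vector \<Rightarrow> 'a \<Rightarrow> 'a set" where
  "oseg u v = {t *\<^sub>R u + (1 - t) *\<^sub>R v | t. 0 < t \<and> t < 1}"

(* f is a total function standing for a map D \<rightarrow> Y; only its values on D matter,
   since oseg x y \<subseteq> D for x, y \<in> D by convexity. *)
definition strict_segment_preserving_on ::
    "'a::real_vector set \<Rightarrow> ('a \<Rightarrow> 'b::real_vector) \<Rightarrow> bool" where
  "strict_segment_preserving_on D f \<longleftrightarrow>
     convex D \<and> (\<forall>x\<in>D. \<forall>y\<in>D. f ` oseg x y = oseg (f x) (f y))"

end

(* With p = B x + b and q = B y + b, the numerator and the denominator of f are affine, so f sends
   t x + (1 - t) y to s (f x) + (1 - s) (f y) with s = t p / (t p + (1 - t) q), and t \<mapsto> s maps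
   ]0,1[ onto itself. *)

theory Submission
  imports Defs
begin

lemma projective_weight_bounds:
  fixes p q t :: real
  assumes "0 < p" "0 < q" "0 < t" "t < 1"
  shows "0 < t * p + (1 - t) * q"
    and "0 < t * p / (t * p + (1 - t) * q)"
    and "t * p / (t * p + (1 - t) * q) < 1"
proof -
  have "0 < t * p" "0 < (1 - t) * q" using assms by simp_all
  then show "0 < t * p + (1 - t) * q"
    and "0 < t * p / (t * p + (1 - t) * q)"
    and "t * p / (t * p + (1 - t) * q) < 1"
    by simp_all
qed

text \<open>The weight map multiplies the odds \<open>t / (1 - t)\<close> by \<open>p / q\<close>.
  Its inverse therefore multiplies the odds by \<open>q / p\<close>, so it is the same map with
  \<open>p\<close> and \<open>q\<close> exchanged, which gives the witness
  \<open>s * q / (s * q + (1 - s) * p)\<close>.\<close>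

lemma projective_weight_surj:
  fixes p q s :: real
  assumes "0 < p" "0 < q" "0 < s" "s < 1"
  obtains t where "0 < t" "t < 1" "s = t * p / (t * p + (1 - t) * q)"
proof
  define w where "w = s * q + (1 - s) * p"
  define t where "t = s * q / w"
  \<comment> \<open>The bounds are instantiated with \<open>p\<close> and \<open>q\<close> swapped,
    since the witness is itself a weight of this form.\<close>
  note bounds = projective_weight_bounds[OF assms(2,1,3,4), folded w_def, folded t_def]
  show "0 < t" "t < 1" by (fact bounds)+
  \<comment> \<open>Both \<open>t * p\<close> and \<open>(1 - t) * q\<close> are multiples of
    \<open>p * q / w\<close>, with coefficients \<open>s\<close> and \<open>1 - s\<close>. They add
    up to \<open>p * q / w\<close>, and this common factor cancels in the quotient.\<close>
  have tp: "t * p = s * (p * q / w)" by (simp add: t_def)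
  have "1 - t = (1 - s) * p / w"
    using bounds(1) by (simp add: t_def field_simps) (simp add: w_def algebra_simps)
  then have "(1 - t) * q = (1 - s) * (p * q / w)" by simp
  with tp have "t * p + (1 - t) * q = p * q / w"
    by (simp only: flip: distrib_right) simp
  with tp show "s = t * p / (t * p + (1 - t) * q)" using assms bounds(1) by simp
qed

theorem theorem1:
  fixes A :: "'a::real_vector \<Rightarrow> 'b::real_vector"
    and B :: "'a \<Rightarrow> real"
    and a :: 'b
    and b :: real
    and D :: "'a set"
    and f :: "'a \<Rightarrow> 'b"
  assumes "linear A"
    and "linear B"
    and "D = {x. B x + b > 0}"
    and "\<And>x. x \<in> D \<Longrightarrow> f x = (A x + a) /\<^sub>R (B x + b)"
  shows "strict_segment_preserving_on D f"
proof -
  interpret A: linear A by fact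
  interpret B: linear B by fact
  have denom: "B (u *\<^sub>R x + v *\<^sub>R y) + b = u * (B x + b) + v * (B y + b)"
    if "u + v = 1" for u v x y
  proof -
    \<comment> \<open>The constant term is shared out between the two points in the proportion
      \<open>u\<close> to \<open>v\<close>.\<close>
    have "b = (u + v) * b" using that by simp
    then show ?thesis by (simp add: B.add B.scale algebra_simps)
  qed
  have "convex D"
    unfolding convex_def
  proof (intro ballI allI impI)
    fix x y u v
    assume "x \<in> D" "y \<in> D" and uv: "0 \<le> u" "0 \<le> v" "u + v = (1::real)"
    then have "0 < B x + b" "0 < B y + b" by (simp_all add: assms(3))
    \<comment> \<open>The weights may vanish here, but not both: \<open>u = 0\<close> forces
      \<open>v = 1\<close>, and otherwise the first summand is positive.\<close>
    then have "0 < u * (B x + b) + v * (B y + b)"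
      using uv by (cases "u = 0") (auto intro: add_pos_nonneg)
    then show "u *\<^sub>R x + v *\<^sub>R y \<in> D" by (simp add: assms(3) denom[OF uv(3)])
  qed
  moreover have "f ` oseg x y = oseg (f x) (f y)" if "x \<in> D" "y \<in> D" for x y
  proof -
    define p q where "p = B x + b" and "q = B y + b"
    have pq: "0 < p" "0 < q" using that by (simp_all add: p_def q_def assms(3))
    define s where "s t = t * p / (t * p + (1 - t) * q)" for t
    have f_seg: "f (t *\<^sub>R x + (1 - t) *\<^sub>R y) = s t *\<^sub>R f x + (1 - s t) *\<^sub>R f y"
      if t: "0 < t" "t < 1" for t
    proof -
      define z w where "z = t *\<^sub>R x + (1 - t) *\<^sub>R y" and "w = t * p + (1 - t) * q"
      have w: "0 < w" unfolding w_def by (rule projective_weight_bounds[OF pq t])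
      have Bz: "B z + b = w" using denom[of t "1 - t" x y] by (simp add: z_def w_def p_def q_def)
      \<comment> \<open>Clearing denominators at the endpoints turns the weights \<open>t\<close>
        and \<open>1 - t\<close> of the numerators into weights \<open>t * p\<close> and
        \<open>(1 - t) * q\<close> of the values of \<open>f\<close>.\<close>
      have num: "A x + a = p *\<^sub>R f x" "A y + a = q *\<^sub>R f y"
        using pq assms(4)[OF \<open>x \<in> D\<close>] assms(4)[OF \<open>y \<in> D\<close>] by (simp_all add: p_def q_def)
      have "A z + a = t *\<^sub>R (A x + a) + (1 - t) *\<^sub>R (A y + a)"
        unfolding z_def A.add A.scale by (simp add: algebra_simps)
      also have "\<dots> = (t * p) *\<^sub>R f x + ((1 - t) * q) *\<^sub>R f y" by (simp add: num)
      finally have Az: "A z + a = (t * p) *\<^sub>R f x + ((1 - t) * q) *\<^sub>R f y" .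
      have "z \<in> D" using Bz w by (simp add: assms(3))
      then have "f z = (A z + a) /\<^sub>R w" using assms(4) Bz by simp
      also have "\<dots> = (t * p / w) *\<^sub>R f x + ((1 - t) * q / w) *\<^sub>R f y"
        by (simp add: Az scaleR_add_right divide_inverse mult.commute)
      \<comment> \<open>The two coefficients sum to 1 because \<open>w\<close> is the sum of their
        numerators.\<close>
      also have "(1 - t) * q / w = 1 - s t"
        using w by (simp add: s_def flip: w_def) (simp add: field_simps w_def)
      finally show ?thesis by (simp add: s_def z_def w_def)
    qed
    \<comment> \<open>Both inclusions compare parameters rather than points, so coinciding endpoints
      need no separate case.\<close>
    show ?thesis
    proof (intro equalityI subsetI)
      fix v assume "v \<in> f ` oseg x y"
      then obtain t where t: "0 < t" "t < 1" and "v = f (t *\<^sub>R x + (1 - t) *\<^sub>R y)"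
        by (auto simp: oseg_def)
      then have "v = s t *\<^sub>R f x + (1 - s t) *\<^sub>R f y" by (simp add: f_seg)
      moreover have "0 < s t" "s t < 1"
        unfolding s_def by (rule projective_weight_bounds[OF pq t])+
      ultimately show "v \<in> oseg (f x) (f y)" unfolding oseg_def by blast
    next
      fix v assume "v \<in> oseg (f x) (f y)"
      then obtain r where r: "0 < r" "r < 1" and v: "v = r *\<^sub>R f x + (1 - r) *\<^sub>R f y"
        by (auto simp: oseg_def)
      \<comment> \<open>The weight \<open>r\<close> on the image segment is pulled back to a
        parameter of the original segment.\<close>
      obtain t where t: "0 < t" "t < 1" and "r = s t"
        unfolding s_def using projective_weight_surj[OF pq r] .
      then have "v = f (t *\<^sub>R x + (1 - t) *\<^sub>R y)" using v by (simp add: f_seg)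
      moreover have "t *\<^sub>R x + (1 - t) *\<^sub>R y \<in> oseg x y" using t unfolding oseg_def by blast
      ultimately show "v \<in> f ` oseg x y" by blast
    qed
  qed
  ultimately show ?thesis by (simp add: strict_segment_preserving_on_def)
qed

end
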